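(* Let $q\ge2$ be an integer, let $(X,T)$ be a $\mathbb{Z}^q$-t.d.s. with metric $d$, let $\mu\in M(X,T)$, and let $\vec{v}=(1,\beta_2,\ldots,\beta_q)\in\mathbb{R}^q$ be a direction vector. Then for any $\mathbf{b}\in\mathbb{R}^{q-1}_+$ the following two statements are equivalent: (a) $\mu$ has bounded complexity with respect to $\{d_k^{\vec{v},\mathbf{b}}\}_{k=1}^\infty$; (b) $T$ is $(\mu,\vec{v},\mathbf{b})$-equicontinuous.
   Context: A $\mathbb{Z}^q$-t.d.s. $(X,T)$ is a compact metric space $(X,d)$ with a group homomorphism $\vec{w}\mapsto T^{\vec{w}}$ from $\mathbb{Z}^q$ to the group of homeomorphisms of $X$. $M(X,T)$ is the set of Borel probability measures $\mu$ on $X$ with $\mu(T^{-\vec{w}}A)=\mu(A)$ for all $\vec{w}\in\mathbb{Z}^q$ and Borel $A$. $\mathbb{R}^{q-1}_+$ is the set of vectors in $\mathbb{R}^{q-1}$ with all coordinates $>0$. For $\mathbf{b}=(b_2,\ldots,b_q)\in\mathbb{R}^{q-1}_+$ let $$\Lambda^{\vec{v}}(\mathbf{b})=\{(m_1,\ldots,m_q)\in\mathbb{Z}^q:\beta_im_1-b_i\le m_i\le\beta_im_1+b_i,\ i=2,\ldots,q\}$$ and, for $k\in\mathbb{N}=\{1,2,\dots\}$, $\Lambda_k^{\vec{v}}(\mathbf{b})=\Lambda^{\vec{v}}(\mathbf{b})\cap(\{0,1,\dots,k-1\}\times\mathbb{Z}^{q-1})$. For $x,y\in X$ define $$d_k^{\vec{v},\mathbf{b}}(x,y)=\max_{\vec{w}\in\Lambda_k^{\vec{v}}(\mathbf{b})}d(T^{\vec{w}}x,T^{\vec{w}}y),$$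 and $B_{d_k^{\vec{v},\mathbf{b}}}(x,\epsilon)=\{y\in X:d_k^{\vec{v},\mathbf{b}}(x,y)<\epsilon\}$. $\mu$ has bounded complexity with respect to $\{d_k^{\vec{v},\mathbf{b}}\}$ if for every $\epsilon>0$ there is a positive integer $C=C(\epsilon)$ such that for every $k\in\mathbb{N}$ there is a finite $F\subset X$ with cardinality $\#(F)\le C$ and $\mu\big(\bigcup_{x\in F}B_{d_k^{\vec{v},\mathbf{b}}}(x,\epsilon)\big)>1-\epsilon$. A subset $K\subset X$ is $(\vec{v},\mathbf{b})$-equicontinuous if for every $\epsilon>0$ there is $\delta>0$ such that for all $x,y\in K$ with $d(x,y)<\delta$, $d(T^{\vec{w}}x,T^{\vec{w}}y)<\epsilon$ for all $\vec{w}\in\Lambda^{\vec{v}}(\mathbf{b})$. $T$ is $(\mu,\vec{v},\mathbf{b})$-equicontinuous if for every $\tau>0$ there is a measurable $(\vec{v},\mathbf{b})$-equicontinuous subset $K\subset X$ with $\mu(K)>1-\tau$. *)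

theory Defs
  imports "HOL-Probability.Probability"
begin

text \<open>
  The group \<open>\<int>\<^sup>q\<close> with \<open>q = CARD('n) + 1\<close> is the type \<open>int \<times> (int ^ 'n)\<close> with its componentwise
  addition: the first component is \<open>m\<^sub>1\<close> and the second one is \<open>(m\<^sub>2, \<dots>, m\<^sub>q)\<close>. As \<open>'n\<close> ranges
  over the (nonempty) finite types, \<open>q\<close> ranges over all integers \<open>q \<ge> 2\<close>. Likewise
  \<open>\<real>\<^sup>q\<^sup>-\<^sup>1\<close> is \<open>real ^ 'n\<close>, and the phase space is a whole type.
\<close>

definition tds :: "(int \<times> (int ^ 'n) \<Rightarrow> 'a::metric_space \<Rightarrow> 'a) \<Rightarrow> bool" where
  "tds T \<longleftrightarrow> compact (UNIV :: 'a set) \<and>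
     (\<forall>w. \<exists>g. homeomorphism UNIV UNIV (T w) g) \<and>
     (\<forall>u w. T (u + w) = T u \<circ> T w)"

definition invariant_measures ::
    "(int \<times> (int ^ 'n) \<Rightarrow> 'a::metric_space \<Rightarrow> 'a) \<Rightarrow> 'a measure set" where
  "invariant_measures T = {\<mu>. prob_space \<mu> \<and> sets \<mu> = sets borel \<and>
     (\<forall>w. \<forall>A\<in>sets borel. measure \<mu> (T (- w) ` A) = measure \<mu> A)}"

definition pos_vectors :: "(real ^ 'n) set" where
  "pos_vectors = {b. \<forall>i. b $ i > 0}"

definition Lambda :: "real \<times> (real ^ 'n) \<Rightarrow> real ^ 'n \<Rightarrow> (int \<times> (int ^ 'n)) set" where
  "Lambda v b = {m. \<forall>i.
     snd v $ i * of_int (fst m) - b $ i \<le> of_int (snd m $ i) \<and>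
     of_int (snd m $ i) \<le> snd v $ i * of_int (fst m) + b $ i}"

definition Lambda_upto ::
    "real \<times> (real ^ 'n) \<Rightarrow> real ^ 'n \<Rightarrow> nat \<Rightarrow> (int \<times> (int ^ 'n)) set" where
  "Lambda_upto v b k = Lambda v b \<inter> ({0..<int k} \<times> UNIV)"

definition dir_dist :: "(int \<times> (int ^ 'n) \<Rightarrow> 'a::metric_space \<Rightarrow> 'a) \<Rightarrow>
    real \<times> (real ^ 'n) \<Rightarrow> real ^ 'n \<Rightarrow> nat \<Rightarrow> 'a \<Rightarrow> 'a \<Rightarrow> real" where
  "dir_dist T v b k x y = Max ((\<lambda>w. dist (T w x) (T w y)) ` Lambda_upto v b k)"

text \<open>The maximum is taken over a finite set, nonempty for positive \<open>b\<close> and \<open>k \<ge> 1\<close>.\<close>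

lemma finite_Lambda_upto: "finite (Lambda_upto v b k)"
proof -
  define g :: "int \<Rightarrow> 'a \<Rightarrow> int set" where
    "g = (\<lambda>m i. {\<lceil>snd v $ i * of_int m - b $ i\<rceil>..\<lfloor>snd v $ i * of_int m + b $ i\<rfloor>})"
  have "finite ((\<lambda>f. \<chi> i. f i) ` (PiE UNIV (g m)))" for m
    by (intro finite_imageI finite_PiE) (auto simp: g_def)
  then have "finite (SIGMA m:{0..<int k}. (\<lambda>f. \<chi> i. f i) ` (PiE UNIV (g m)))"
    by blast
  moreover have "Lambda_upto v b k \<subseteq> (SIGMA m:{0..<int k}. (\<lambda>f. \<chi> i. f i) ` (PiE UNIV (g m)))"
  proof
    fix p assume p: "p \<in> Lambda_upto v b k"
    have "($) (snd p) \<in> PiE UNIV (g (fst p))"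
      using p by (auto simp: Lambda_upto_def Lambda_def g_def ceiling_le_iff le_floor_iff)
    then have "snd p \<in> (\<lambda>f. \<chi> i. f i) ` (PiE UNIV (g (fst p)))"
      by (metis (no_types, lifting) image_eqI vec_lambda_eta)
    then show "p \<in> (SIGMA m:{0..<int k}. (\<lambda>f. \<chi> i. f i) ` (PiE UNIV (g m)))"
      using p by (cases p) (auto simp: Lambda_upto_def)
  qed
  ultimately show ?thesis by (rule finite_subset[rotated])
qed

lemma zero_in_Lambda_upto:
  assumes "b \<in> pos_vectors" "k \<ge> 1"
  shows "0 \<in> Lambda_upto v b k"
  using assms
  by (auto simp: pos_vectors_def Lambda_upto_def Lambda_def zero_prod_def less_imp_le)

definition bounded_complexity ::
    "'a measure \<Rightarrow> (nat \<Rightarrow> 'a \<Rightarrow> 'a \<Rightarrow> real) \<Rightarrow> bool" where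
  "bounded_complexity \<mu> d \<longleftrightarrow>
     (\<forall>\<epsilon>>0. \<exists>C\<ge>1. \<forall>k\<ge>1. \<exists>F. finite F \<and> card F \<le> C \<and>
        measure \<mu> (\<Union>x\<in>F. {y. d k x y < \<epsilon>}) > 1 - \<epsilon>)"

definition equicontinuous_set :: "(int \<times> (int ^ 'n) \<Rightarrow> 'a::metric_space \<Rightarrow> 'a) \<Rightarrow>
    real \<times> (real ^ 'n) \<Rightarrow> real ^ 'n \<Rightarrow> 'a set \<Rightarrow> bool" where
  "equicontinuous_set T v b K \<longleftrightarrow>
     (\<forall>\<epsilon>>0. \<exists>\<delta>>0. \<forall>x\<in>K. \<forall>y\<in>K. dist x y < \<delta> \<longrightarrow>
        (\<forall>w\<in>Lambda v b. dist (T w x) (T w y) < \<epsilon>))"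

definition mu_equicontinuous :: "'a measure \<Rightarrow> (int \<times> (int ^ 'n) \<Rightarrow> 'a::metric_space \<Rightarrow> 'a) \<Rightarrow>
    real \<times> (real ^ 'n) \<Rightarrow> real ^ 'n \<Rightarrow> bool" where
  "mu_equicontinuous \<mu> T v b \<longleftrightarrow>
     (\<forall>\<tau>>0. \<exists>K\<in>sets \<mu>. equicontinuous_set T v b K \<and> measure \<mu> K > 1 - \<tau>)"

end

theory Submission
  imports Defs
begin

text \<open>
  That (b) implies (a) is total boundedness of an equicontinuous set. For the converse, bounded
  complexity only sees times \<open>m\<^sub>1 \<ge> 0\<close>, whereas equicontinuity is about the two-sided strip. By
  Dirichlet's theorem there are lattice vectors \<open>w\<close> far out in the strip and arbitrarily close to
  the direction \<open>v\<close>. Translation by such a \<open>w\<close> moves a finite two-sided window of the strip into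
  its forward half, and invariance of \<open>\<mu>\<close> transports the covers back. Lattice points exactly on
  the boundary of the strip may leave it under translation, but only finitely many of them are
  affected, and those are harmless by uniform continuity. Letting the window grow and extracting
  limits of the centres of the covers yields, up to small measure, a finite closed cover by sets of
  small diameter in the supremum metric over the strip.
\<close>

section \<open>Compactness: limits of covers by a bounded number of balls\<close>

text \<open>The subsequence is refined once per index, and limits already obtained survive the
  refinement. This lets all centres of the covers converge simultaneously.\<close>

lemma convergent_subsequence_finite_family:
  fixes x :: "nat \<Rightarrow> 'i \<Rightarrow> 'a::metric_space"
  assumes "compact (UNIV :: 'a set)" "finite I"
  shows "\<exists>r z. strict_mono r \<and> (\<forall>i\<in>I. (\<lambda>k. x (r k) i) \<longlonglongrightarrow> z i)"
  using assms(2)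
proof (induction I rule: finite_induct)
  case empty
  show ?case by (auto intro: exI[of _ id] simp: strict_mono_def)
next
  case (insert j I)
  then obtain r z where r: "strict_mono r" "\<forall>i\<in>I. (\<lambda>k. x (r k) i) \<longlonglongrightarrow> z i"
    by blast
  obtain l s where s: "strict_mono s" "((\<lambda>k. x (r k) j) \<circ> s) \<longlonglongrightarrow> l"
    using seq_compactE[OF assms(1)[unfolded compact_eq_seq_compact_metric], of "\<lambda>k. x (r k) j"]
    by blast
  have "(\<lambda>k. x ((r \<circ> s) k) i) \<longlonglongrightarrow> (z(j := l)) i" if "i \<in> insert j I" for i
  proof (cases "i = j")
    case True
    then show ?thesis using s(2) by (simp add: o_def)
  next
    case False
    then have "(\<lambda>k. x (r k) i) \<longlonglongrightarrow> z i" using r(2) that by blast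
    from LIMSEQ_subseq_LIMSEQ[OF this s(1)] False show ?thesis by (simp add: o_def)
  qed
  moreover have "strict_mono (r \<circ> s)" using r(1) s(1) by (rule strict_mono_o)
  ultimately show ?case by blast
qed

text \<open>An intersection of closed sets is closed for any \<open>W\<close>, so this serves the
  infinite union of all windows. The open version below is for a single finite window.\<close>

lemma closed_orbit_ball:
  fixes T :: "'i \<Rightarrow> 'a::metric_space \<Rightarrow> 'a"
  assumes "\<And>u. continuous_on UNIV (T u)"
  shows "closed {y. \<forall>u\<in>W. dist (T u z) (T u y) \<le> e}"
proof -
  have "{y. \<forall>u\<in>W. dist (T u z) (T u y) \<le> e} = (\<Inter>u\<in>W. {y. dist (T u z) (T u y) \<le> e})"
    by auto
  also have "closed \<dots>"
    by (intro closed_INT ballI closed_Collect_le continuous_intros assms)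
  finally show ?thesis .
qed

lemma open_orbit_ball:
  fixes T :: "'i \<Rightarrow> 'a::metric_space \<Rightarrow> 'a"
  assumes "\<And>u. continuous_on UNIV (T u)" "finite W"
  shows "open {y. \<forall>u\<in>W. dist (T u z) (T u y) < e}"
proof -
  have "{y. \<forall>u\<in>W. dist (T u z) (T u y) < e} = (\<Inter>u\<in>W. {y. dist (T u z) (T u y) < e})"
    by auto
  also have "open \<dots>"
    by (intro open_INT ballI open_Collect_less continuous_intros assms)
  finally show ?thesis .
qed

text \<open>As \<open>C\<close> does not depend on \<open>k\<close>, the centres of the
  \<open>k\<close>-th cover can be listed as a \<open>C\<close>-tuple, and a subsequence of these
  tuples converges. A cover for a late window also covers for every earlier one, so the limit
  centres serve each \<open>W j\<close> at the price of doubling the radius. Continuity of the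
  measure from above then passes to the union of the windows.\<close>

lemma bounded_complexity_limit_cover:
  fixes T :: "'i \<Rightarrow> 'a::metric_space \<Rightarrow> 'a" and W :: "nat \<Rightarrow> 'i set"
  assumes compact: "compact (UNIV :: 'a set)"
    and prob: "prob_space \<mu>" and sets: "sets \<mu> = sets borel"
    and cont: "\<And>u. continuous_on UNIV (T u)"
    and fin: "\<And>k. finite (W k)" and mono: "incseq W"
    and e: "e > 0"
    and cov: "\<And>k. \<exists>F. finite F \<and> card F \<le> C \<and>
       measure \<mu> (\<Union>x\<in>F. {y. \<forall>u\<in>W k. dist (T u x) (T u y) < e}) > 1 - e"
  shows "\<exists>F. finite F \<and>
    measure \<mu> (\<Union>x\<in>F. {y. \<forall>u\<in>(\<Union>k. W k). dist (T u x) (T u y) \<le> 2 * e}) \<ge> 1 - e"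
proof -
  interpret prob_space \<mu> by (rule prob)
  have "\<exists>f. measure \<mu> (\<Union>i<C. {y. \<forall>u\<in>W k. dist (T u (f i)) (T u y) < e}) > 1 - e" for k
  proof -
    obtain F where F: "finite F" "card F \<le> C"
      "measure \<mu> (\<Union>x\<in>F. {y. \<forall>u\<in>W k. dist (T u x) (T u y) < e}) > 1 - e"
      using cov by blast
    \<comment> \<open>The values of \<open>h\<close> from \<open>card F\<close> on are arbitrary:
      surplus balls only enlarge the union.\<close>
    obtain h where h: "bij_betw h {..<card F} F"
      using ex_bij_betw_nat_finite[OF F(1)] by (auto simp: atLeast0LessThan)
    have "(\<Union>x\<in>F. {y. \<forall>u\<in>W k. dist (T u x) (T u y) < e})
        \<subseteq> (\<Union>i<C. {y. \<forall>u\<in>W k. dist (T u (h i)) (T u y) < e})"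
    proof
      fix y assume "y \<in> (\<Union>x\<in>F. {y. \<forall>u\<in>W k. dist (T u x) (T u y) < e})"
      then obtain x where x: "x \<in> F" "\<forall>u\<in>W k. dist (T u x) (T u y) < e" by blast
      then obtain i where "i < card F" "x = h i" using h by (auto simp: bij_betw_def)
      then show "y \<in> (\<Union>i<C. {y. \<forall>u\<in>W k. dist (T u (h i)) (T u y) < e})"
        using x(2) F(2) by (intro UN_I[of i]) auto
    qed
    moreover have "(\<Union>i<C. {y. \<forall>u\<in>W k. dist (T u (h i)) (T u y) < e}) \<in> sets \<mu>"
      unfolding sets by (intro borel_open open_UN ballI open_orbit_ball cont fin)
    ultimately have "measure \<mu> (\<Union>x\<in>F. {y. \<forall>u\<in>W k. dist (T u x) (T u y) < e})
        \<le> measure \<mu> (\<Union>i<C. {y. \<forall>u\<in>W k. dist (T u (h i)) (T u y) < e})"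
      by (rule finite_measure_mono)
    with F(3) show ?thesis by (intro exI[of _ h]) linarith
  qed
  then have "\<exists>x. \<forall>k. measure \<mu> (\<Union>i<C. {y. \<forall>u\<in>W k. dist (T u (x k i)) (T u y) < e}) > 1 - e"
    by (intro choice allI)
  then obtain x where x: "\<And>k. measure \<mu> (\<Union>i<C. {y. \<forall>u\<in>W k. dist (T u (x k i)) (T u y) < e}) > 1 - e"
    by blast
  obtain r z where r: "strict_mono r" and z': "\<forall>i\<in>{..<C}. (\<lambda>k. x (r k) i) \<longlonglongrightarrow> z i"
    using convergent_subsequence_finite_family[OF compact finite_lessThan[of C], where x = x]
    by blast
  have z: "(\<lambda>k. x (r k) i) \<longlonglongrightarrow> z i" if "i < C" for i using z' that by simp
  define A where "A j = (\<Union>i<C. {y. \<forall>u\<in>W j. dist (T u (z i)) (T u y) \<le> 2 * e})" for j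
  have Asets: "A j \<in> sets \<mu>" for j
    unfolding A_def sets
    by (intro borel_closed closed_UN ballI closed_orbit_ball cont finite_lessThan)
  have Ameas: "measure \<mu> (A j) \<ge> 1 - e" for j
  proof -
    have "\<forall>\<^sub>F k in sequentially. dist (T u (x (r k) i)) (T u (z i)) < e" if "i < C" for u i
    proof (rule tendstoD[OF _ e])
      have "isCont (T u) (z i)" using cont by (simp add: continuous_on_eq_continuous_at)
      then show "(\<lambda>k. T u (x (r k) i)) \<longlonglongrightarrow> T u (z i)"
        by (rule isCont_tendsto_compose[OF _ z[OF that]])
    qed
    then have "\<forall>\<^sub>F k in sequentially. \<forall>i\<in>{..<C}. \<forall>u\<in>W j. dist (T u (x (r k) i)) (T u (z i)) < e"
      by (intro eventually_ball_finite ballI fin finite_lessThan) auto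
    then have "\<forall>\<^sub>F k in sequentially. j \<le> k \<and>
        (\<forall>i\<in>{..<C}. \<forall>u\<in>W j. dist (T u (x (r k) i)) (T u (z i)) < e)"
      by (intro eventually_conj eventually_ge_at_top)
    from eventually_happens'[OF sequentially_bot this]
    obtain k where k: "j \<le> k"
      "\<And>i u. i < C \<Longrightarrow> u \<in> W j \<Longrightarrow> dist (T u (x (r k) i)) (T u (z i)) < e"
      by auto
    \<comment> \<open>Here \<open>r k \<ge> k \<ge> j\<close>, which is the purpose of the clause
      \<open>j \<le> k\<close>.\<close>
    have "W j \<subseteq> W (r k)"
      using mono k(1) seq_suble[OF r, of k] by (meson incseqD le_trans)
    have "(\<Union>i<C. {y. \<forall>u\<in>W (r k). dist (T u (x (r k) i)) (T u y) < e}) \<subseteq> A j"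
    proof
      fix y assume "y \<in> (\<Union>i<C. {y. \<forall>u\<in>W (r k). dist (T u (x (r k) i)) (T u y) < e})"
      then obtain i where i: "i < C" "\<And>u. u \<in> W (r k) \<Longrightarrow> dist (T u (x (r k) i)) (T u y) < e"
        by auto
      have "dist (T u (z i)) (T u y) \<le> 2 * e" if "u \<in> W j" for u
        using i(2)[of u] k(2)[OF i(1) that] that \<open>W j \<subseteq> W (r k)\<close>
          dist_triangle3[of "T u (z i)" "T u y" "T u (x (r k) i)"] by auto
      then show "y \<in> A j" using i(1) by (auto simp: A_def)
    qed
    from finite_measure_mono[OF this Asets] x[of "r k"] show ?thesis by linarith
  qed
  have "decseq A"
  proof (rule decseq_SucI, rule subsetI)
    fix j y assume "y \<in> A (Suc j)"
    then obtain i where i: "i < C" "\<And>u. u \<in> W (Suc j) \<Longrightarrow> dist (T u (z i)) (T u y) \<le> 2 * e"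
      by (auto simp: A_def)
    moreover have "W j \<subseteq> W (Suc j)" using mono by (simp add: incseq_SucD)
    ultimately show "y \<in> A j" unfolding A_def by blast
  qed
  have "(\<lambda>j. measure \<mu> (A j)) \<longlonglongrightarrow> measure \<mu> (\<Inter>j. A j)"
    using Asets \<open>decseq A\<close> by (intro finite_Lim_measure_decseq) auto
  then have le: "1 - e \<le> measure \<mu> (\<Inter>j. A j)"
    by (rule LIMSEQ_le_const) (use Ameas in auto)
  \<comment> \<open>The decreasing intersection is exchanged with the finite union: if
    \<open>y\<close> failed for each centre at some window, it would fail for all centres at the
    largest of these windows.\<close>
  have "(\<Inter>j. A j) \<subseteq> (\<Union>i<C. {y. \<forall>u\<in>(\<Union>k. W k). dist (T u (z i)) (T u y) \<le> 2 * e})"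
  proof (rule subsetI, rule ccontr)
    fix y assume y: "y \<in> (\<Inter>j. A j)"
      "y \<notin> (\<Union>i<C. {y. \<forall>u\<in>(\<Union>k. W k). dist (T u (z i)) (T u y) \<le> 2 * e})"
    then have "\<forall>i\<in>{..<C}. \<exists>k. \<exists>u\<in>W k. \<not> dist (T u (z i)) (T u y) \<le> 2 * e"
      by auto
    from bchoice[OF this]
    obtain k where k: "\<And>i. i < C \<Longrightarrow> \<exists>u\<in>W (k i). \<not> dist (T u (z i)) (T u y) \<le> 2 * e"
      by blast
    \<comment> \<open>For \<open>C = 0\<close> this \<open>Max\<close> is unspecified, but then
      \<open>A m\<close> is empty and the contradiction remains.\<close>
    define m where "m = Max (k ` {..<C})"
    have "\<exists>u\<in>W m. \<not> dist (T u (z i)) (T u y) \<le> 2 * e" if "i < C" for i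
    proof -
      have "k i \<le> m" unfolding m_def using that by (intro Max_ge) auto
      then show ?thesis using k[OF that] incseqD[OF mono] by blast
    qed
    moreover have "y \<in> A m" using y(1) by blast
    ultimately show False by (auto simp: A_def)
  qed
  moreover have "(\<Union>i<C. {y. \<forall>u\<in>(\<Union>k. W k). dist (T u (z i)) (T u y) \<le> 2 * e}) \<in> sets \<mu>"
    unfolding sets
    by (intro borel_closed closed_UN ballI closed_orbit_ball cont finite_lessThan)
  ultimately have "measure \<mu> (\<Inter>j. A j)
      \<le> measure \<mu> (\<Union>i<C. {y. \<forall>u\<in>(\<Union>k. W k). dist (T u (z i)) (T u y) \<le> 2 * e})"
    by (rule finite_measure_mono)
  then have "1 - e \<le> measure \<mu> (\<Union>x\<in>z ` {..<C}. {y. \<forall>u\<in>(\<Union>k. W k). dist (T u x) (T u y) \<le> 2 * e})"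
    using le by simp
  then show ?thesis by (intro exI[of _ "z ` {..<C}"]) simp
qed

section \<open>Discarding collars and intersecting over countably many scales\<close>

text \<open>Off a closed set \<open>infdist\<close> is positive, so the collars decrease to the
  empty set. For empty \<open>A\<close> the default value 0 of \<open>infdist\<close> would make
  every collar the whole space.\<close>

lemma measure_collar_tendsto_0:
  fixes A :: "'a::metric_space set"
  assumes "prob_space \<mu>" and sets: "sets \<mu> = sets borel" and A: "closed A" "A \<noteq> {}"
  shows "(\<lambda>n. measure \<mu> ({x. infdist x A < 1 / Suc n} - A)) \<longlonglongrightarrow> 0"
proof -
  interpret prob_space \<mu> by fact
  let ?N = "\<lambda>n. {x. infdist x A < 1 / Suc n} - A"
  have "?N n \<in> sets \<mu>" for n
    unfolding sets using A(1)
    by (intro borel_open open_Diff open_Collect_less continuous_intros)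
  moreover have "decseq ?N"
  proof (rule decseq_SucI)
    fix n
    have "1 / real (Suc (Suc n)) \<le> 1 / real (Suc n)" by (simp add: field_simps)
    then show "?N (Suc n) \<subseteq> ?N n" by (auto intro: less_le_trans)
  qed
  ultimately have "(\<lambda>n. measure \<mu> (?N n)) \<longlonglongrightarrow> measure \<mu> (\<Inter>n. ?N n)"
    by (intro finite_Lim_measure_decseq) auto
  moreover have "(\<Inter>n. ?N n) = {}"
  proof -
    have False if "\<And>n. infdist x A < 1 / Suc n" "x \<notin> A" for x
    proof -
      have "infdist x A > 0"
        using A that(2) in_closed_iff_infdist_zero[OF A] infdist_nonneg[of x A]
        by (metis less_eq_real_def)
      then obtain n where "1 / real (Suc n) < infdist x A" by (meson nat_approx_posE)
      then show False using that(1)[of n] by linarith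
    qed
    then show ?thesis by auto
  qed
  ultimately show ?thesis by (simp only: measure_empty)
qed

text \<open>Points outside a piece \<open>A x\<close> of the cover but within \<open>\<delta>\<close> of it are thrown away. What is left
  is separated enough that two \<open>\<delta>\<close>-close points share a piece, so the pieces need not be disjoint.\<close>

lemma bounded_complexity_good_set:
  fixes T :: "'i \<Rightarrow> 'a::metric_space \<Rightarrow> 'a" and W :: "nat \<Rightarrow> 'i set"
  assumes compact: "compact (UNIV :: 'a set)"
    and prob: "prob_space \<mu>" and sets: "sets \<mu> = sets borel"
    and cont: "\<And>u. continuous_on UNIV (T u)"
    and fin: "\<And>k. finite (W k)" and mono: "incseq W"
    and cov: "\<And>e. e > 0 \<Longrightarrow> \<exists>C. \<forall>k. \<exists>F. finite F \<and> card F \<le> C \<and>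
       measure \<mu> (\<Union>x\<in>F. {y. \<forall>u\<in>W k. dist (T u x) (T u y) < e}) > 1 - e"
    and \<epsilon>: "\<epsilon> > 0" and \<eta>: "\<eta> > 0"
  shows "\<exists>K\<in>sets \<mu>. \<exists>\<delta>>0. measure \<mu> K > 1 - \<eta> \<and>
    (\<forall>x\<in>K. \<forall>y\<in>K. dist x y < \<delta> \<longrightarrow> (\<forall>u\<in>(\<Union>k. W k). dist (T u x) (T u y) < \<epsilon>))"
proof -
  interpret prob_space \<mu> by (rule prob)
  \<comment> \<open>Two points of one piece are \<open>2 * e + 2 * e\<close> apart at most, to be
    below \<open>\<epsilon>\<close>; the measure lost is \<open>e\<close> to the cover and
    \<open>e\<close> to the collars, to be below \<open>\<eta>\<close>.\<close>
  define e where "e = min (\<epsilon> / 5) (\<eta> / 3)"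
  have e: "e > 0" "4 * e < \<epsilon>" "2 * e < \<eta>" using \<epsilon> \<eta> by (auto simp: e_def min_def)
  define A where "A x = {y. \<forall>u\<in>(\<Union>k. W k). dist (T u x) (T u y) \<le> 2 * e}" for x
  obtain F where F: "finite F" and FA: "measure \<mu> (\<Union>x\<in>F. A x) \<ge> 1 - e"
    using bounded_complexity_limit_cover[OF compact prob sets cont fin mono e(1)] cov[OF e(1)]
    unfolding A_def by meson
  have Acl: "closed (A x)" for x unfolding A_def by (rule closed_orbit_ball[OF cont])
  \<comment> \<open>Makes each piece nonempty, as the collar lemma requires.\<close>
  have self: "x \<in> A x" for x using e(1) by (simp add: A_def)
  define N where "N n x = {y. infdist y (A x) < 1 / real (Suc n)} - A x" for n x
  have Nsets: "N n x \<in> sets \<mu>" for n x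
    unfolding N_def sets using Acl
    by (intro borel_open open_Diff open_Collect_less continuous_intros)
  have "(\<lambda>n. measure \<mu> (N n x)) \<longlonglongrightarrow> 0" for x
    unfolding N_def using self[of x] by (intro measure_collar_tendsto_0 prob sets Acl) auto
  then have "(\<lambda>n. \<Sum>x\<in>F. measure \<mu> (N n x)) \<longlonglongrightarrow> (\<Sum>x\<in>F. 0)"
    by (intro tendsto_sum)
  then have "\<forall>\<^sub>F n in sequentially. (\<Sum>x\<in>F. measure \<mu> (N n x)) < e"
    using e(1) by (intro order_tendstoD(2)) auto
  then obtain n where n: "(\<Sum>x\<in>F. measure \<mu> (N n x)) < e"
    using eventually_happens'[OF sequentially_bot] by blast
  define K where "K = (\<Union>x\<in>F. A x) - (\<Union>x\<in>F. N n x)"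
  have UA: "(\<Union>x\<in>F. A x) \<in> sets \<mu>"
    unfolding sets by (intro borel_closed closed_UN ballI Acl F)
  have UN: "(\<Union>x\<in>F. N n x) \<in> sets \<mu>" using F Nsets by (intro sets.finite_UN) auto
  have "measure \<mu> (\<Union>x\<in>F. N n x) \<le> (\<Sum>x\<in>F. measure \<mu> (N n x))"
    using F Nsets by (intro finite_measure_subadditive_finite) auto
  then have less: "measure \<mu> (\<Union>x\<in>F. N n x) < e" using n by linarith
  have "measure \<mu> (\<Union>x\<in>F. A x) \<le> measure \<mu> (K \<union> (\<Union>x\<in>F. N n x))"
    using UA UN by (intro finite_measure_mono) (auto simp: K_def)
  also have "\<dots> \<le> measure \<mu> K + measure \<mu> (\<Union>x\<in>F. N n x)"
    using UA UN by (intro measure_Un_le) (auto simp: K_def)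
  finally have "measure \<mu> K > 1 - \<eta>" using FA less e(3) by linarith
  moreover have "dist (T u x) (T u y) < \<epsilon>"
    if K: "x \<in> K" "y \<in> K" and d: "dist x y < 1 / Suc n" and u: "u \<in> (\<Union>k. W k)" for x y u
  proof -
    obtain z where z: "z \<in> F" "x \<in> A z" using K(1) by (auto simp: K_def)
    \<comment> \<open>Being near \<open>A z\<close> but outside its collar, \<open>y\<close> must
      lie in \<open>A z\<close> itself.\<close>
    have "infdist y (A z) < 1 / Suc n"
      using infdist_le[OF z(2), of y] d by (simp add: dist_commute)
    then have "y \<in> A z" using K(2) z(1) by (auto simp: K_def N_def)
    then have "dist (T u z) (T u x) \<le> 2 * e" "dist (T u z) (T u y) \<le> 2 * e"
      using z(2) u unfolding A_def by blast+
    then show ?thesis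
      using e(2) dist_triangle3[of "T u x" "T u y" "T u z"] by linarith
  qed
  moreover have "K \<in> sets \<mu>" using UA UN by (auto simp: K_def)
  ultimately show ?thesis
    by (intro bexI[of _ K] exI[of _ "1 / real (Suc n)"]) auto
qed

text \<open>The complements have total measure at most the sum of
  \<open>\<tau> / 2 ^ (m + 2)\<close>, which is \<open>\<tau> / 2\<close>; the exponent is chosen so
  that the final inequality stays strict.\<close>

lemma (in prob_space) prob_INT_gt:
  fixes K :: "nat \<Rightarrow> 'a set"
  assumes K: "\<And>m. K m \<in> events" "\<And>m. prob (K m) > 1 - \<tau> / 2 ^ (m + 2)" and \<tau>: "\<tau> > 0"
  shows "prob (\<Inter>m. K m) > 1 - \<tau>"
proof -
  have le: "prob (space M - K m) \<le> \<tau> / 4 * (1 / 2) ^ m" for m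
    using prob_compl[OF K(1)[of m]] K(2)[of m] by (simp add: power_add power_divide)
  have "(\<lambda>m. \<tau> / 4 * (1 / 2) ^ m) sums (\<tau> / 4 * (1 / (1 - 1 / 2)))"
    by (intro sums_mult geometric_sums) auto
  then have s: "(\<lambda>m. \<tau> / 4 * (1 / 2) ^ m) sums (\<tau> / 2)" by simp
  have sm: "summable (\<lambda>m. prob (space M - K m))"
    by (rule summable_comparison_test'[OF sums_summable[OF s], of 0]) (use le in auto)
  have "prob (\<Union>m. space M - K m) \<le> (\<Sum>m. prob (space M - K m))"
    using K(1) sm by (intro finite_measure_subadditive_countably) auto
  also have "\<dots> \<le> \<tau> / 2"
    using suminf_le[OF le sm sums_summable[OF s]] sums_unique[OF s] by simp
  finally have "prob (\<Union>m. space M - K m) \<le> \<tau> / 2" .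
  moreover have "(\<Union>m. space M - K m) = space M - (\<Inter>m. K m)" by auto
  moreover have "(\<Inter>m. K m) \<in> events" using K(1) by auto
  ultimately show ?thesis using prob_compl[of "\<Inter>m. K m"] \<tau> by simp
qed

section \<open>Lattice geometry of the strip\<close>

text \<open>The offset of coordinate \<open>i\<close> from the line spanned by
  \<open>(1, \<beta>)\<close>. It is additive in \<open>u\<close>, and the strip becomes a symmetric
  box in the offsets, so translations can be followed coordinate by coordinate.\<close>

definition dev :: "real ^ 'n \<Rightarrow> int \<times> (int ^ 'n) \<Rightarrow> 'n \<Rightarrow> real" where
  "dev \<beta> u i = of_int (snd u $ i) - \<beta> $ i * of_int (fst u)"

lemma dev_add: "dev \<beta> (u + w) i = dev \<beta> u i + dev \<beta> w i"
  by (simp add: dev_def algebra_simps)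

lemma dev_minus: "dev \<beta> (- u) i = - dev \<beta> u i"
  by (simp add: dev_def)

lemma mem_Lambda_iff_dev: "u \<in> Lambda (a, \<beta>) b \<longleftrightarrow> (\<forall>i. \<bar>dev \<beta> u i\<bar> \<le> b $ i)"
  by (auto simp: Lambda_def dev_def abs_le_iff algebra_simps)

text \<open>The strip is invariant under negation, so a two-sided window lies in a forward window
  together with its reflection.\<close>

lemma finite_Lambda_window: "finite {u \<in> Lambda (a, \<beta>) b. \<bar>fst u\<bar> \<le> k}"
proof -
  let ?U = "Lambda_upto (a, \<beta>) b (nat k + 1)"
  have "u \<in> ?U \<union> uminus ` ?U" if "u \<in> Lambda (a, \<beta>) b" "\<bar>fst u\<bar> \<le> k" for u
  proof (cases "fst u \<ge> 0")
    case True
    then show ?thesis using that by (cases u) (auto simp: Lambda_upto_def)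
  next
    case False
    have "- u \<in> Lambda (a, \<beta>) b"
      using that(1) by (simp add: mem_Lambda_iff_dev dev_minus)
    then have "- u \<in> ?U" using that(2) False by (cases u) (auto simp: Lambda_upto_def)
    then have "- (- u) \<in> uminus ` ?U" by (rule imageI)
    then show ?thesis by simp
  qed
  then have "{u \<in> Lambda (a, \<beta>) b. \<bar>fst u\<bar> \<le> k} \<subseteq> ?U \<union> uminus ` ?U" by blast
  then show ?thesis
    by (rule finite_subset) (intro finite_UnI finite_imageI finite_Lambda_upto)
qed

text \<open>In a coordinate with rational \<open>\<beta>\<^sub>i\<close> boundary points are unproblematic: the deviations there
  are discrete, so a translation with small deviation has deviation 0.\<close>

definition irrational_boundary :: "real ^ 'n \<Rightarrow> real ^ 'n \<Rightarrow> (int \<times> (int ^ 'n)) set" where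
  "irrational_boundary \<beta> b =
     {u \<in> Lambda (1, \<beta>) b. \<exists>i. \<beta> $ i \<notin> \<rat> \<and> \<bar>dev \<beta> u i\<bar> = b $ i}"

text \<open>For irrational \<open>\<beta> $ i\<close> the offset in coordinate \<open>i\<close>
  determines the first component of a lattice point, since otherwise \<open>\<beta> $ i\<close>
  would be a quotient of integers. Hence each face of the strip, at offset \<open>b $ i\<close> or
  \<open>- b $ i\<close>, meets a single time slice, which is finite.\<close>

lemma finite_irrational_boundary: "finite (irrational_boundary \<beta> b)"
proof -
  define S where "S i c = {u \<in> Lambda (1, \<beta>) b. dev \<beta> u i = c}" for i c
  have fst_eq: "fst u = fst w" if "\<beta> $ i \<notin> \<rat>" "dev \<beta> u i = dev \<beta> w i" for u w i
  proof (rule ccontr)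
    assume "fst u \<noteq> fst w"
    moreover have "\<beta> $ i * of_int (fst u - fst w) = of_int (snd u $ i - snd w $ i)"
      using that(2) by (simp add: dev_def right_diff_distrib)
    ultimately have "\<beta> $ i = of_int (snd u $ i - snd w $ i) / of_int (fst u - fst w)"
      by (simp add: eq_divide_eq)
    also have "\<dots> \<in> \<rat>" by (intro Rats_divide Rats_of_int)
    finally show False using that(1) by blast
  qed
  have fin: "finite (S i c)" if "\<beta> $ i \<notin> \<rat>" for i c
  proof (cases "S i c = {}")
    case False
    then obtain w where "w \<in> S i c" by blast
    have "S i c \<subseteq> {u \<in> Lambda (1, \<beta>) b. \<bar>fst u\<bar> \<le> \<bar>fst w\<bar>}"
    proof
      fix u assume "u \<in> S i c"
      with \<open>w \<in> S i c\<close> have "fst u = fst w" by (intro fst_eq[OF that]) (simp add: S_def)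
      then show "u \<in> {u \<in> Lambda (1, \<beta>) b. \<bar>fst u\<bar> \<le> \<bar>fst w\<bar>}"
        using \<open>u \<in> S i c\<close> by (simp add: S_def)
    qed
    then show ?thesis using finite_Lambda_window by (rule finite_subset)
  qed simp
  have "irrational_boundary \<beta> b \<subseteq> (\<Union>i\<in>{i. \<beta> $ i \<notin> \<rat>}. S i (b $ i) \<union> S i (- b $ i))"
  proof
    fix u assume "u \<in> irrational_boundary \<beta> b"
    then obtain i where i: "u \<in> Lambda (1, \<beta>) b" "\<beta> $ i \<notin> \<rat>" "\<bar>dev \<beta> u i\<bar> = b $ i"
      unfolding irrational_boundary_def by blast
    then have "dev \<beta> u i = b $ i \<or> dev \<beta> u i = - b $ i" by linarith
    then show "u \<in> (\<Union>i\<in>{i. \<beta> $ i \<notin> \<rat>}. S i (b $ i) \<union> S i (- b $ i))"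
      using i(1,2) unfolding S_def by blast
  qed
  then show ?thesis by (rule finite_subset) (use fin in auto)
qed

text \<open>Simultaneous Dirichlet approximation is applied to the multiples
  \<open>Suc N * \<beta> $ i\<close> instead of \<open>\<beta> $ i\<close>: the time
  \<open>q * Suc N\<close> then exceeds \<open>N\<close> even if the denominator \<open>q\<close> is
  small.\<close>

lemma directional_recurrence:
  fixes \<beta> :: "real ^ 'n"
  assumes "\<delta> > 0"
  shows "\<exists>w. fst w \<ge> int N \<and> (\<forall>i. \<bar>dev \<beta> w i\<bar> < \<delta>)"
proof -
  obtain h where h: "bij_betw h {..<CARD('n)} (UNIV :: 'n set)"
    using ex_bij_betw_nat_finite[of "UNIV :: 'n set"] by (auto simp: atLeast0LessThan)
  obtain M where M: "1 / real (Suc M) < \<delta>" using nat_approx_posE[OF assms] by blast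
  obtain q p where q: "q > 0"
    and qp: "\<And>j. j < CARD('n) \<Longrightarrow>
      \<bar>of_int q * (real (Suc N) * \<beta> $ h j) - of_int (p j)\<bar> < 1 / real (Suc M)"
    using Dirichlet_approx_simult[of "Suc M" "CARD('n)" "\<lambda>j. real (Suc N) * \<beta> $ h j"]
    by (metis zero_less_Suc)
  \<comment> \<open>Dirichlet's theorem indexes the coordinates by numbers; \<open>g\<close>
    translates back.\<close>
  define g where "g = inv_into {..<CARD('n)} h"
  have g: "g i < CARD('n)" "h (g i) = i" for i
    using h inv_into_into[of i h "{..<CARD('n)}"] f_inv_into_f[of i h "{..<CARD('n)}"]
    by (auto simp: g_def bij_betw_def)
  define w :: "int \<times> (int ^ 'n)" where "w = (q * int (Suc N), \<chi> i. p (g i))"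
  have "\<bar>dev \<beta> w i\<bar> < \<delta>" for i
  proof -
    have "dev \<beta> w i = - (of_int q * (real (Suc N) * \<beta> $ h (g i)) - of_int (p (g i)))"
      by (simp add: dev_def w_def g(2) algebra_simps)
    then show ?thesis using qp[OF g(1)[of i]] M by linarith
  qed
  moreover have "1 * int N \<le> q * int (Suc N)" using q by (intro mult_mono) auto
  ultimately show ?thesis by (intro exI[of _ w]) (auto simp: w_def)
qed

text \<open>An interior offset leaves room \<open>b $ i - \<bar>dev \<beta> u i\<bar>\<close>. An
  offset on the boundary forces \<open>\<beta> $ i\<close> to be rational, say \<open>p / q\<close>;
  offsets of \<open>w\<close> are then multiples of \<open>1 / q\<close>, so a smaller one
  vanishes.\<close>

lemma dev_small_shift:
  assumes u: "u \<in> Lambda (1, \<beta>) b - irrational_boundary \<beta> b"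
  shows "\<exists>d>0. \<forall>w. \<bar>dev \<beta> w i\<bar> < d \<longrightarrow> \<bar>dev \<beta> (u + w) i\<bar> \<le> b $ i"
proof (cases "\<bar>dev \<beta> u i\<bar> < b $ i")
  case True
  have "\<bar>dev \<beta> (u + w) i\<bar> \<le> b $ i" if "\<bar>dev \<beta> w i\<bar> < b $ i - \<bar>dev \<beta> u i\<bar>" for w
    using that unfolding dev_add by linarith
  then show ?thesis using True by (intro exI[of _ "b $ i - \<bar>dev \<beta> u i\<bar>"]) auto
next
  case False
  have le: "\<bar>dev \<beta> u i\<bar> \<le> b $ i" using u by (simp add: mem_Lambda_iff_dev)
  then have "\<beta> $ i \<in> \<rat>" using u False by (auto simp: irrational_boundary_def)
  then obtain p q where pq: "q > 0" "\<beta> $ i = of_int p / of_int q"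
    by (rule Rats_cases') auto
  have "\<bar>dev \<beta> (u + w) i\<bar> \<le> b $ i" if w: "\<bar>dev \<beta> w i\<bar> < 1 / of_int q" for w
  proof -
    have eq: "dev \<beta> w i = of_int (q * snd w $ i - p * fst w) / of_int q"
      using pq by (simp add: dev_def field_simps)
    have "\<bar>real_of_int (q * snd w $ i - p * fst w)\<bar> < 1"
      using w pq(1) unfolding eq by (simp add: abs_divide divide_less_cancel del: of_int_diff)
    then have "q * snd w $ i - p * fst w = 0" by linarith
    then have "dev \<beta> w i = 0" unfolding eq by simp
    then show ?thesis using le by (simp add: dev_add)
  qed
  then show ?thesis using pq(1) by (intro exI[of _ "1 / of_int q"]) auto
qed

text \<open>Finitely many points \<open>u\<close> and coordinates \<open>i\<close> share one
  threshold \<open>d\<close>. A translation \<open>w\<close> with offsets below \<open>d\<close>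
  keeps them in the strip, and one of time at least \<open>k\<close> makes all their times
  nonnegative.\<close>

lemma window_shift:
  fixes \<beta> b :: "real ^ 'n"
  shows "\<exists>w K. \<forall>u\<in>Lambda (1, \<beta>) b - irrational_boundary \<beta> b.
    \<bar>fst u\<bar> \<le> int k \<longrightarrow> u + w \<in> Lambda_upto (1, \<beta>) b K"
proof -
  define W where
    "W = {u \<in> Lambda (1, \<beta>) b. \<bar>fst u\<bar> \<le> int k} - irrational_boundary \<beta> b"
  have "finite W" unfolding W_def using finite_Lambda_window by blast
  \<comment> \<open>Stated as an eventual property at 0 from the right, so that no explicit minimum
    of thresholds is needed.\<close>
  have "\<forall>\<^sub>F d in at_right 0. \<forall>w. \<bar>dev \<beta> w i\<bar> < d \<longrightarrow> \<bar>dev \<beta> (u + w) i\<bar> \<le> b $ i"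
    if u: "u \<in> W" for u i
  proof -
    obtain d where d: "d > 0" "\<And>w. \<bar>dev \<beta> w i\<bar> < d \<Longrightarrow> \<bar>dev \<beta> (u + w) i\<bar> \<le> b $ i"
      using dev_small_shift[of u \<beta> b i] u by (auto simp: W_def)
    show ?thesis
      unfolding eventually_at_right_field
      by (rule exI[of _ d]) (use d in auto)
  qed
  then have "\<forall>\<^sub>F d in at_right 0. \<forall>u\<in>W. \<forall>i.
      \<forall>w. \<bar>dev \<beta> w i\<bar> < d \<longrightarrow> \<bar>dev \<beta> (u + w) i\<bar> \<le> b $ i"
    by (intro eventually_ball_finite \<open>finite W\<close> ballI eventually_all_finite) auto
  then have "\<forall>\<^sub>F d in at_right (0::real). d > 0 \<and> (\<forall>u\<in>W. \<forall>i.
      \<forall>w. \<bar>dev \<beta> w i\<bar> < d \<longrightarrow> \<bar>dev \<beta> (u + w) i\<bar> \<le> b $ i)"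
    by (intro eventually_conj eventually_at_right_less)
  from eventually_happens'[OF _ this]
  obtain d where d: "d > 0"
    "\<And>u i w. u \<in> W \<Longrightarrow> \<bar>dev \<beta> w i\<bar> < d \<Longrightarrow> \<bar>dev \<beta> (u + w) i\<bar> \<le> b $ i"
    by (auto simp del: split_paired_All)
  obtain w where w: "fst w \<ge> int k" "\<And>i. \<bar>dev \<beta> w i\<bar> < d"
    using directional_recurrence[OF d(1)] by blast
  \<comment> \<open>The times of \<open>u + w\<close> reach at most \<open>k + fst w\<close>; the 1
    is added because \<open>Lambda_upto\<close> excludes its upper end.\<close>
  have "u + w \<in> Lambda_upto (1, \<beta>) b (nat (int k + fst w + 1))"
    if "u \<in> Lambda (1, \<beta>) b - irrational_boundary \<beta> b" "\<bar>fst u\<bar> \<le> int k" for u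
  proof -
    have "u \<in> W" using that by (auto simp: W_def)
    then have "u + w \<in> Lambda (1, \<beta>) b" using d(2) w(2) by (simp add: mem_Lambda_iff_dev)
    moreover have "fst (u + w) \<in> {0..<int (nat (int k + fst w + 1))}" using that(2) w(1) by auto
    ultimately show ?thesis by (cases "u + w") (auto simp: Lambda_upto_def)
  qed
  then show ?thesis by blast
qed

section \<open>The two implications\<close>

lemma dir_dist_less_iff:
  assumes "b \<in> pos_vectors" "k \<ge> 1"
  shows "dir_dist T v b k x y < e \<longleftrightarrow> (\<forall>u\<in>Lambda_upto v b k. dist (T u x) (T u y) < e)"
  using zero_in_Lambda_upto[OF assms, of v] finite_Lambda_upto[of v b k]
  unfolding dir_dist_def by (subst Max_less_iff) auto

lemma tds_continuous_on: "tds T \<Longrightarrow> continuous_on UNIV (T w)"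
  unfolding tds_def homeomorphism_def by blast

lemma tds_add: "tds T \<Longrightarrow> T (u + w) x = T u (T w x)"
  by (simp add: tds_def del: split_paired_All)

text \<open>Equicontinuity controls all of the strip at once, so a single finite
  \<open>d\<close>-net of \<open>K\<close> serves every \<open>k\<close>.\<close>

lemma mu_equicontinuous_imp_bounded_complexity:
  fixes T :: "int \<times> (int ^ 'n) \<Rightarrow> 'a::metric_space \<Rightarrow> 'a"
  assumes T: "tds T" and prob: "prob_space \<mu>" and sets: "sets \<mu> = sets borel"
    and b: "b \<in> pos_vectors" and equi: "mu_equicontinuous \<mu> T v b"
  shows "bounded_complexity \<mu> (dir_dist T v b)"
  unfolding bounded_complexity_def
proof (intro allI impI)
  fix e :: real assume e: "e > 0"
  interpret prob_space \<mu> by (rule prob)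
  obtain K where K: "K \<in> sets \<mu>" "equicontinuous_set T v b K" "measure \<mu> K > 1 - e"
    using equi e unfolding mu_equicontinuous_def by blast
  obtain d where d: "d > 0"
    "\<And>x y u. x \<in> K \<Longrightarrow> y \<in> K \<Longrightarrow> dist x y < d \<Longrightarrow> u \<in> Lambda v b \<Longrightarrow> dist (T u x) (T u y) < e"
    using K(2) e unfolding equicontinuous_set_def by metis
  have "compact (UNIV :: 'a set)" using T by (simp add: tds_def)
  then obtain G :: "'a set" where G: "finite G" "UNIV \<subseteq> (\<Union>x\<in>G. ball x (d / 2))"
    using d(1) unfolding compact_eq_totally_bounded by (meson half_gt_zero)
  \<comment> \<open>Equicontinuity compares points of \<open>K\<close> only, so the centre of each
    ball meeting \<open>K\<close> is replaced by a point of \<open>K\<close> in that ball; the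
    radius \<open>d / 2\<close> leaves room for this.\<close>
  define c where "c g = (SOME x. x \<in> K \<and> dist g x < d / 2)" for g
  define F where "F = c ` {g \<in> G. \<exists>x\<in>K. dist g x < d / 2}"
  have F: "finite F" using G(1) by (simp add: F_def)
  have near: "\<exists>x\<in>F. x \<in> K \<and> dist x y < d" if y: "y \<in> K" for y
  proof -
    have "y \<in> (\<Union>x\<in>G. ball x (d / 2))" using G(2) by blast
    then obtain g where g: "g \<in> G" "dist g y < d / 2" by auto
    then have "c g \<in> K \<and> dist g (c g) < d / 2"
      unfolding c_def using y by (intro someI[of "\<lambda>x. x \<in> K \<and> dist g x < d / 2" y]) auto
    then show ?thesis
      using g y dist_triangle3[of "c g" y g] unfolding F_def by (intro bexI[of _ "c g"]) auto
  qed
  have "measure \<mu> (\<Union>x\<in>F. {y. dir_dist T v b k x y < e}) > 1 - e" if k: "k \<ge> 1" for k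
  proof -
    have "K \<subseteq> (\<Union>x\<in>F. {y. dir_dist T v b k x y < e})"
    proof
      fix y assume y: "y \<in> K"
      obtain x where x: "x \<in> F" "x \<in> K" "dist x y < d" using near[OF y] by blast
      have "dir_dist T v b k x y < e"
        unfolding dir_dist_less_iff[OF b k]
        using d(2)[OF x(2) y x(3)] by (auto simp: Lambda_upto_def)
      then show "y \<in> (\<Union>x\<in>F. {y. dir_dist T v b k x y < e})" using x(1) by blast
    qed
    moreover have "(\<Union>x\<in>F. {y. dir_dist T v b k x y < e}) \<in> sets \<mu>"
      unfolding dir_dist_less_iff[OF b k] sets
      by (intro borel_open open_UN ballI open_orbit_ball tds_continuous_on T finite_Lambda_upto)
    ultimately have "measure \<mu> K \<le> measure \<mu> (\<Union>x\<in>F. {y. dir_dist T v b k x y < e})"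
      by (rule finite_measure_mono)
    then show ?thesis using K(3) by linarith
  qed
  then show "\<exists>C\<ge>1. \<forall>k\<ge>1. \<exists>F. finite F \<and> card F \<le> C \<and>
      measure \<mu> (\<Union>x\<in>F. {y. dir_dist T v b k x y < e}) > 1 - e"
    \<comment> \<open>\<open>Suc\<close> because \<open>C \<ge> 1\<close> is demanded while
      \<open>F\<close> may be empty when \<open>e > 1\<close>.\<close>
    using F by (intro exI[of _ "Suc (card F)"]) auto
qed

text \<open>The translation \<open>w\<close> varies with \<open>k\<close>, but pushing a cover
  forward by \<open>T w\<close> neither adds centres nor changes its measure, so the constant
  \<open>C\<close> of the forward windows is kept.\<close>

lemma bounded_complexity_two_sided:
  fixes T :: "int \<times> (int ^ 'n) \<Rightarrow> 'a::metric_space \<Rightarrow> 'a"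
  assumes T: "tds T" and \<mu>: "\<mu> \<in> invariant_measures T" and b: "b \<in> pos_vectors"
    and bc: "bounded_complexity \<mu> (dir_dist T (1, \<beta>) b)" and e: "e > 0"
  shows "\<exists>C. \<forall>k. \<exists>F. finite F \<and> card F \<le> C \<and>
    measure \<mu> (\<Union>x\<in>F. {y. \<forall>u\<in>{u \<in> Lambda (1, \<beta>) b. \<bar>fst u\<bar> \<le> int k} - irrational_boundary \<beta> b.
      dist (T u x) (T u y) < e}) > 1 - e"
proof -
  have "prob_space \<mu>" and sets: "sets \<mu> = sets borel"
    and inv: "\<And>w A. A \<in> sets borel \<Longrightarrow> measure \<mu> (T (- w) ` A) = measure \<mu> A"
    using \<mu> by (auto simp: invariant_measures_def)
  interpret prob_space \<mu> by fact
  obtain C where C: "\<And>k. k \<ge> 1 \<Longrightarrow> \<exists>F. finite F \<and> card F \<le> C \<and>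
      measure \<mu> (\<Union>x\<in>F. {y. dir_dist T (1, \<beta>) b k x y < e}) > 1 - e"
    using bc e unfolding bounded_complexity_def by meson
  have "\<exists>F. finite F \<and> card F \<le> C \<and>
    measure \<mu> (\<Union>x\<in>F. {y. \<forall>u\<in>{u \<in> Lambda (1, \<beta>) b. \<bar>fst u\<bar> \<le> int k} - irrational_boundary \<beta> b.
      dist (T u x) (T u y) < e}) > 1 - e" for k
  proof -
    let ?W = "{u \<in> Lambda (1, \<beta>) b. \<bar>fst u\<bar> \<le> int k} - irrational_boundary \<beta> b"
    obtain w K where wK: "\<And>u. u \<in> ?W \<Longrightarrow> u + w \<in> Lambda_upto (1, \<beta>) b K"
      using window_shift[of \<beta> b k] by blast
    \<comment> \<open>\<open>K\<close> may be 0, whereas bounded complexity speaks of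
      \<open>k \<ge> 1\<close>.\<close>
    have sub: "Lambda_upto (1, \<beta>) b K \<subseteq> Lambda_upto (1, \<beta>) b (Suc K)"
      by (auto simp: Lambda_upto_def)
    obtain F where F: "finite F" "card F \<le> C"
      "measure \<mu> (\<Union>x\<in>F. {y. dir_dist T (1, \<beta>) b (Suc K) x y < e}) > 1 - e"
      using C[of "Suc K"] by auto
    let ?B = "\<Union>x\<in>F. {y. dir_dist T (1, \<beta>) b (Suc K) x y < e}"
    let ?V = "\<Union>x\<in>T w ` F. {y. \<forall>u\<in>?W. dist (T u x) (T u y) < e}"
    have iff: "dir_dist T (1, \<beta>) b (Suc K) x y < e \<longleftrightarrow>
        (\<forall>u\<in>Lambda_upto (1, \<beta>) b (Suc K). dist (T u x) (T u y) < e)" for x y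
      using b by (intro dir_dist_less_iff) auto
    have "T w ` ?B \<subseteq> ?V"
    proof (rule image_subsetI)
      fix y assume "y \<in> ?B"
      then obtain x where x: "x \<in> F" "dir_dist T (1, \<beta>) b (Suc K) x y < e" by blast
      have "dist (T u (T w x)) (T u (T w y)) < e" if "u \<in> ?W" for u
        using x(2) wK[OF that] sub unfolding iff tds_add[OF T, symmetric] by blast
      then show "T w y \<in> ?V" using x(1) by blast
    qed
    moreover have "?V \<in> sets \<mu>"
      unfolding sets using finite_Lambda_window[of 1 \<beta> b "int k"]
      by (intro borel_open open_UN ballI open_orbit_ball tds_continuous_on T finite_Diff)
    ultimately have "measure \<mu> (T w ` ?B) \<le> measure \<mu> ?V"
      by (rule finite_measure_mono)
    moreover have "?B \<in> sets borel"
      unfolding iff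
      by (intro borel_open open_UN ballI open_orbit_ball tds_continuous_on T finite_Lambda_upto)
    \<comment> \<open>Invariance is stated for images under \<open>T (- w)\<close>, hence the
      instance \<open>- w\<close>.\<close>
    then have "measure \<mu> (T w ` ?B) = measure \<mu> ?B" using inv[of ?B "- w"] by simp
    ultimately have "measure \<mu> ?V > 1 - e" using F(3) by linarith
    moreover have "card (T w ` F) \<le> C" using card_image_le[OF F(1)] F(2) le_trans by blast
    ultimately show ?thesis using F(1) by (intro exI[of _ "T w ` F"] conjI finite_imageI)
  qed
  then show ?thesis by blast
qed

text \<open>Takes care of the finitely many exceptional lattice points, on all of the space.\<close>

lemma uniformly_equicontinuous_finite:
  fixes T :: "'i \<Rightarrow> 'a::metric_space \<Rightarrow> 'a"
  assumes "compact (UNIV :: 'a set)" "\<And>u. continuous_on UNIV (T u)" "finite E" "\<epsilon> > 0"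
  shows "\<exists>\<delta>>0. \<forall>x y. dist x y < \<delta> \<longrightarrow> (\<forall>u\<in>E. dist (T u x) (T u y) < \<epsilon>)"
proof -
  have "\<forall>\<^sub>F d in at_right 0. \<forall>x y. dist x y < d \<longrightarrow> dist (T u x) (T u y) < \<epsilon>" for u
  proof -
    have "uniformly_continuous_on UNIV (T u)"
      using assms(1,2) by (rule compact_uniformly_continuous[rotated])
    then obtain d where d: "d > 0" "\<And>x y. dist x y < d \<Longrightarrow> dist (T u x) (T u y) < \<epsilon>"
      using assms(4) unfolding uniformly_continuous_on_def by (metis UNIV_I)
    show ?thesis unfolding eventually_at_right_field
      by (rule exI[of _ d]) (use d in auto)
  qed
  then have "\<forall>\<^sub>F d in at_right 0. \<forall>u\<in>E. \<forall>x y. dist x y < d \<longrightarrow> dist (T u x) (T u y) < \<epsilon>"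
    by (intro eventually_ball_finite assms(3)) auto
  then have "\<forall>\<^sub>F d in at_right (0::real). d > 0 \<and>
      (\<forall>u\<in>E. \<forall>x y. dist x y < d \<longrightarrow> dist (T u x) (T u y) < \<epsilon>)"
    by (intro eventually_conj eventually_at_right_less)
  from eventually_happens'[OF _ this] show ?thesis by auto
qed

text \<open>The good sets obtained so far depend on the accuracy. Intersecting them over the
  accuracies \<open>1 / Suc m\<close>, with summable losses of measure, gives one set that works for
  every \<open>\<epsilon>\<close>.\<close>

lemma bounded_complexity_imp_mu_equicontinuous:
  fixes T :: "int \<times> (int ^ 'n) \<Rightarrow> 'a::metric_space \<Rightarrow> 'a"
  assumes T: "tds T" and \<mu>: "\<mu> \<in> invariant_measures T" and b: "b \<in> pos_vectors"
    and bc: "bounded_complexity \<mu> (dir_dist T (1, \<beta>) b)"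
  shows "mu_equicontinuous \<mu> T (1, \<beta>) b"
  unfolding mu_equicontinuous_def
proof (intro allI impI)
  fix \<tau> :: real assume \<tau>: "\<tau> > 0"
  have prob: "prob_space \<mu>" and sets: "sets \<mu> = sets borel"
    using \<mu> by (auto simp: invariant_measures_def)
  interpret prob_space \<mu> by (rule prob)
  have compact: "compact (UNIV :: 'a set)" using T by (simp add: tds_def)
  define W where
    "W k = {u \<in> Lambda (1, \<beta>) b. \<bar>fst u\<bar> \<le> int k} - irrational_boundary \<beta> b" for k
  have W: "Lambda (1, \<beta>) b \<subseteq> (\<Union>k. W k) \<union> irrational_boundary \<beta> b"
  proof
    fix u assume "u \<in> Lambda (1, \<beta>) b"
    then show "u \<in> (\<Union>k. W k) \<union> irrational_boundary \<beta> b"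
      by (auto simp: W_def intro!: exI[of _ "nat \<bar>fst u\<bar>"])
  qed
  have finW: "finite (W k)" for k
    unfolding W_def by (intro finite_Diff finite_Lambda_window)
  have monoW: "incseq W" by (auto simp: W_def incseq_def)
  have cov: "\<exists>C. \<forall>k. \<exists>F. finite F \<and> card F \<le> C \<and>
       measure \<mu> (\<Union>x\<in>F. {y. \<forall>u\<in>W k. dist (T u x) (T u y) < e}) > 1 - e" if "e > 0" for e
    unfolding W_def by (rule bounded_complexity_two_sided[OF T \<mu> b bc that])
  have "\<forall>m. \<exists>K. K \<in> sets \<mu> \<and> measure \<mu> K > 1 - \<tau> / 2 ^ (m + 2) \<and> (\<exists>\<delta>>0.
    \<forall>x\<in>K. \<forall>y\<in>K. dist x y < \<delta> \<longrightarrow> (\<forall>u\<in>(\<Union>k. W k). dist (T u x) (T u y) < 1 / Suc m))"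
  proof
    fix m
    have "1 / real (Suc m) > 0" "\<tau> / 2 ^ (m + 2) > 0" using \<tau> by auto
    from bounded_complexity_good_set[OF compact prob sets tds_continuous_on[OF T] finW monoW cov this]
    show "\<exists>K. K \<in> sets \<mu> \<and> measure \<mu> K > 1 - \<tau> / 2 ^ (m + 2) \<and> (\<exists>\<delta>>0.
      \<forall>x\<in>K. \<forall>y\<in>K. dist x y < \<delta> \<longrightarrow> (\<forall>u\<in>(\<Union>k. W k). dist (T u x) (T u y) < 1 / Suc m))"
      by blast
  qed
  from choice[OF this] obtain K where K: "\<And>m. K m \<in> sets \<mu>"
    "\<And>m. measure \<mu> (K m) > 1 - \<tau> / 2 ^ (m + 2)"
    "\<And>m. \<exists>\<delta>>0. \<forall>x\<in>K m. \<forall>y\<in>K m. dist x y < \<delta> \<longrightarrow>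
      (\<forall>u\<in>(\<Union>k. W k). dist (T u x) (T u y) < 1 / Suc m)"
    by blast
  have "equicontinuous_set T (1, \<beta>) b (\<Inter>m. K m)"
    unfolding equicontinuous_set_def
  proof (intro allI impI)
    fix \<epsilon> :: real assume \<epsilon>: "\<epsilon> > 0"
    obtain m where m: "1 / real (Suc m) < \<epsilon>" using nat_approx_posE[OF \<epsilon>] by blast
    obtain d where d: "d > 0" "\<And>x y u. x \<in> K m \<Longrightarrow> y \<in> K m \<Longrightarrow> dist x y < d \<Longrightarrow>
        u \<in> (\<Union>k. W k) \<Longrightarrow> dist (T u x) (T u y) < 1 / Suc m"
      using K(3)[of m] by blast
    have "\<exists>\<delta>>0. \<forall>x y. dist x y < \<delta> \<longrightarrow>
        (\<forall>u\<in>irrational_boundary \<beta> b. dist (T u x) (T u y) < \<epsilon>)"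
      by (rule uniformly_equicontinuous_finite[OF compact tds_continuous_on[OF T]
          finite_irrational_boundary \<epsilon>])
    then obtain d' where d': "d' > 0" "\<And>x y u. dist x y < d' \<Longrightarrow>
        u \<in> irrational_boundary \<beta> b \<Longrightarrow> dist (T u x) (T u y) < \<epsilon>"
      by blast
    \<comment> \<open>\<open>d\<close> handles the windows and \<open>d'\<close> the exceptional
      points; together they exhaust the strip.\<close>
    have "dist (T u x) (T u y) < \<epsilon>"
      if "x \<in> (\<Inter>m. K m)" "y \<in> (\<Inter>m. K m)" "dist x y < min d d'" "u \<in> Lambda (1, \<beta>) b" for x y u
    proof (cases "u \<in> irrational_boundary \<beta> b")
      case True
      then show ?thesis using d'(2) that(3) by simp
    next
      case False
      then have "u \<in> (\<Union>k. W k)" using W that(4) by blast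
      moreover have "x \<in> K m" "y \<in> K m" using that(1,2) by blast+
      ultimately have "dist (T u x) (T u y) < 1 / Suc m" using d(2) that(3) by simp
      then show ?thesis using m by linarith
    qed
    then show "\<exists>\<delta>>0. \<forall>x\<in>(\<Inter>m. K m). \<forall>y\<in>(\<Inter>m. K m). dist x y < \<delta> \<longrightarrow>
        (\<forall>w\<in>Lambda (1, \<beta>) b. dist (T w x) (T w y) < \<epsilon>)"
      using d(1) d'(1) by (intro exI[of _ "min d d'"]) simp
  qed
  moreover have "measure \<mu> (\<Inter>m. K m) > 1 - \<tau>" by (rule prob_INT_gt[OF K(1,2) \<tau>])
  moreover have "(\<Inter>m. K m) \<in> sets \<mu>" using K(1) by auto
  ultimately show "\<exists>K\<in>sets \<mu>. equicontinuous_set T (1, \<beta>) b K \<and> measure \<mu> K > 1 - \<tau>"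
    by blast
qed

theorem theoremA3:
  fixes T :: "int \<times> (int ^ 'n) \<Rightarrow> 'a::metric_space \<Rightarrow> 'a"
    and \<mu> :: "'a measure"
    and \<beta> b :: "real ^ 'n"
    and v :: "real \<times> (real ^ 'n)"
  assumes "tds T"
    and "\<mu> \<in> invariant_measures T"
    and "v = (1, \<beta>)"
    and "b \<in> pos_vectors"
  shows "bounded_complexity \<mu> (dir_dist T v b) \<longleftrightarrow> mu_equicontinuous \<mu> T v b"
proof
  assume "bounded_complexity \<mu> (dir_dist T v b)"
  then show "mu_equicontinuous \<mu> T v b"
    using bounded_complexity_imp_mu_equicontinuous[OF assms(1,2,4)] assms(3) by simp
next
  assume "mu_equicontinuous \<mu> T v b"
  moreover have "prob_space \<mu>" "sets \<mu> = sets borel"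
    using assms(2) by (auto simp: invariant_measures_def)
  ultimately show "bounded_complexity \<mu> (dir_dist T v b)"
    using mu_equicontinuous_imp_bounded_complexity assms(1,4) by blast
qed

end
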